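(* Let $k\geqslant2$ be an integer and let $F(z)\in\mathbb{C}[[z]]$ be a $k$-Mahler function converging inside the unit disc. If the eigenvalue $\lambda_F$ of $F(z)$ exists and is not an integral power of $k$ (that is, $\lambda_F\neq k^n$ for every $n\in\mathbb{Z}$), then $F(z)$ is transcendental over $\mathbb{C}(z)$.
   Context: A power series $F(z)\in\mathbb{C}[[z]]$ is a $k$-Mahler function ($k\geqslant 2$ an integer) if there are an integer $d\geqslant 1$ and polynomials $a_0(z),\ldots,a_d(z)\in\mathbb{C}[z]$, with $a_d(z)$ not the zero polynomial, such that $\sum_{i=0}^d a_i(z)F(z^{k^i})=0$. "Converging inside the unit disc" means the power series converges for $|z|<1$. With $a_i:=a_i(1)$, the characteristic polynomial of $F$ (with respect to the given functional equation) is $p_F(\lambda):=a_0\lambda^d+a_1\lambda^{d-1}+\cdots+a_{d-1}\lambda+a_d$. The eigenvalue $\lambda_F$ of $F(z)$ is said to exist if there is a nonzero root $\lambda_F\in\mathbb{C}$ of $p_F$ for which, as $z\to1^-$ along the real interval $(0,1)$, $$F(z)=\frac{C(z)}{(1-z)^{\log_k\lambda_F}}(1+o(1)),$$ where $\log_k$ is the principal value of the base-$k$ logarithm, $(1-z)^{\log_k\lambda_F}=\exp(\log_k(\lambda_F)\ln(1-z))$, and $C(z)$ is a (complex-valued) real-analytic function on $(0,1)$ with $|C(z)|$ bounded away from $0$ and $\infty$ on $(0,1)$ and $C(z)=C(z^k)$ for $z\in(0,1)$. *)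

theory Defs
  imports
    "HOL-Analysis.Analysis"
    "HOL-Computational_Algebra.Formal_Laurent_Series"
begin

definition mahler_equation ::
    "nat \<Rightarrow> nat \<Rightarrow> (nat \<Rightarrow> complex poly) \<Rightarrow> complex fps \<Rightarrow> bool" where
  "mahler_equation k d a F \<longleftrightarrow>
     d \<ge> 1 \<and> a d \<noteq> 0 \<and>
     (\<Sum>i\<le>d. fps_of_poly (a i) * (F oo fps_X ^ (k ^ i))) = 0"

text \<open>If \<open>a i\<close> vanishes at 1 for every \<open>i \<le> d\<close>, this is the zero polynomial, and every
  number counts as a root.\<close>

definition mahler_char_poly :: "nat \<Rightarrow> (nat \<Rightarrow> complex poly) \<Rightarrow> complex poly" where
  "mahler_char_poly d a = (\<Sum>i\<le>d. monom (poly (a i) 1) (d - i))"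

definition real_analytic_on :: "(real \<Rightarrow> complex) \<Rightarrow> real set \<Rightarrow> bool" where
  "real_analytic_on f S \<longleftrightarrow>
     (\<forall>x0\<in>S. \<exists>r>0. \<exists>c :: nat \<Rightarrow> complex.
        ball x0 r \<subseteq> S \<and> (\<forall>x\<in>ball x0 r. (\<lambda>n. c n * of_real ((x - x0) ^ n)) sums f x))"

text \<open>The constant \<open>log\<close> of the library is not available for complex arguments;
  \<open>Ln\<close> is the principal branch, with imaginary part in \<open>(-pi, pi]\<close>.\<close>

definition principal_log :: "nat \<Rightarrow> complex \<Rightarrow> complex" where
  "principal_log k w = Ln w / of_real (ln (real k))"

text \<open>The function \<open>h\<close> is the \<open>o(1)\<close> term.\<close>

definition mahler_eigenvalue ::
    "nat \<Rightarrow> nat \<Rightarrow> (nat \<Rightarrow> complex poly) \<Rightarrow> complex fps \<Rightarrow> complex \<Rightarrow> bool" where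
  "mahler_eigenvalue k d a F lam \<longleftrightarrow>
     lam \<noteq> 0 \<and> poly (mahler_char_poly d a) lam = 0 \<and>
     (\<exists>(C :: real \<Rightarrow> complex) (h :: real \<Rightarrow> complex).
        real_analytic_on C {0<..<1} \<and>
        (\<exists>m M. 0 < m \<and> (\<forall>x\<in>{0<..<1}. m \<le> norm (C x) \<and> norm (C x) \<le> M)) \<and>
        (\<forall>x\<in>{0<..<1}. C x = C (x ^ k)) \<and>
        (h \<longlongrightarrow> 0) (at_left 1) \<and>
        (\<forall>\<^sub>F x in at_left 1.
           eval_fps F (of_real x) =
             C x / exp (principal_log k lam * of_real (ln (1 - x))) * (1 + h x)))"

text \<open>The field of rational functions, embedded in the field of formal Laurent series by
  expansion at 0.\<close>

definition rational_fls :: "complex fls set" where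
  "rational_fls =
     {fps_to_fls (fps_of_poly p) / fps_to_fls (fps_of_poly q) | p q. q \<noteq> 0}"

definition transcendental_fps :: "complex fps \<Rightarrow> bool" where
  "transcendental_fps F \<longleftrightarrow>
     \<not> (\<exists>P :: complex fls poly.
          P \<noteq> 0 \<and> (\<forall>i. coeff P i \<in> rational_fls) \<and> poly P (fps_to_fls F) = 0)"

end

theory Submission
  imports Defs "HOL-Complex_Analysis.Complex_Analysis"
begin

text \<open>
  Suppose \<open>F\<close> were algebraic. The argument shows that \<open>F\<close> then extends meromorphically to a
  neighbourhood of the point 1, and that this is incompatible with the assumed asymptotics.

  An algebraic function has only finitely many singularities: let \<open>P\<close> be a polynomial of minimal
  degree with \<open>P(z, F(z)) = 0\<close>. Eliminating the second variable from \<open>P\<close> and its derivative with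
  respect to that variable gives a nonzero polynomial \<open>D(z)\<close> (\<open>annihilator_separable\<close>), and at any
  point of the unit circle where neither \<open>D\<close> nor the leading coefficient of \<open>P\<close> vanishes, \<open>F\<close>
  stays bounded and follows a simple root of \<open>P(z, _)\<close>, hence continues analytically
  (\<open>extends_mero_at_simple_point\<close>).

  The Mahler equation transports extensions along the circle. Near a point \<open>\<zeta>\<close> of the circle,
  \<open>z \<mapsto> z ^ K\<close> is locally biholomorphic and respects the disc, so if \<open>F\<close> extends at
  \<open>\<zeta> ^ (k ^ i)\<close> for all \<open>i < d\<close>, then solving the equation for \<open>F(z ^ (k ^ d))\<close> shows that it
  extends at \<open>\<zeta> ^ (k ^ d)\<close> as well (\<open>extends_mero_mahler_step\<close>). The points \<open>exp(2 pi i / k ^ n)\<close>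
  with \<open>n\<close> large avoid the finite exceptional set, and raising to powers of \<open>k\<close> brings them down
  to 1 (\<open>extends_mero_at_one\<close>).

  Finally, compare \<open>F(x ^ k) / F(x)\<close> as \<open>x\<close> tends to 1 from the left. A meromorphic germ behaves
  like a constant times \<open>(z - 1) ^ n\<close> with an integer \<open>n\<close>, so the ratio tends to \<open>k ^ n\<close>
  (\<open>meromorphic_dilation_ratio\<close>); the eigenvalue asymptotics make it tend to \<open>1 / lam\<close>, because the
  factor \<open>C\<close> cancels (\<open>log_periodic_dilation_ratio\<close>). Hence \<open>lam\<close> is an integral power of \<open>k\<close>.
\<close>

section \<open>Bivariate polynomials and annihilators\<close>

text \<open>The outer variable of the iterated polynomial is \<open>w\<close> and the coefficients are polynomials in
  \<open>z\<close>. Substituting the constant polynomial for \<open>w\<close> first lets the ring homomorphism laws of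
  \<open>poly\<close> apply directly.\<close>

definition bieval :: "complex poly poly \<Rightarrow> complex \<Rightarrow> complex \<Rightarrow> complex" where
  "bieval P z w = poly (poly P [:w:]) z"

lemma bieval_altdef: "bieval P z w = (\<Sum>i\<le>degree P. poly (coeff P i) z * w ^ i)"
  unfolding bieval_def poly_altdef[of P] by (simp add: poly_sum)

lemma bieval_simps [simp]:
  "bieval 0 z w = 0"
  "bieval (pCons p P) z w = poly p z + w * bieval P z w"
  "bieval (P + Q) z w = bieval P z w + bieval Q z w"
  "bieval (P * Q) z w = bieval P z w * bieval Q z w"
  "bieval (smult p P) z w = poly p z * bieval P z w"
  by (simp_all add: bieval_def)

lemma bieval_diff [simp]: "bieval (P - Q) z w = bieval P z w - bieval Q z w"
  by (simp add: bieval_def)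

lemma has_field_derivative_bieval:
  "((\<lambda>w. bieval P z w) has_field_derivative bieval (pderiv P) z w) (at w within S)"
proof (induction P)
  case (pCons p P)
  show ?case
    using pCons.IH by (auto intro!: derivative_eq_intros simp: pderiv_pCons)
qed auto

lemma holomorphic_on_bieval [holomorphic_intros]:
  assumes "f holomorphic_on S" "g holomorphic_on S"
  shows "(\<lambda>z. bieval P (f z) (g z)) holomorphic_on S"
  unfolding bieval_altdef using assms by (auto intro!: holomorphic_intros)

lemma tendsto_bieval [tendsto_intros]:
  assumes "(f \<longlongrightarrow> a) G" "(g \<longlongrightarrow> b) G"
  shows "((\<lambda>x. bieval P (f x) (g x)) \<longlongrightarrow> bieval P a b) G"
  unfolding bieval_altdef using assms by (auto intro!: tendsto_intros)

definition annihilates :: "complex poly poly \<Rightarrow> (complex \<Rightarrow> complex) \<Rightarrow> bool" where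
  "annihilates P f \<longleftrightarrow> (\<forall>z\<in>ball 0 1. bieval P z (f z) = 0)"

text \<open>Annihilators form a prime ideal because holomorphic functions on a connected open set have
  no zero divisors.\<close>

lemma annihilates_multD:
  assumes f: "f holomorphic_on ball 0 1" and PQ: "annihilates (P * Q) f"
  shows "annihilates P f \<or> annihilates Q f"
proof (rule disjCI)
  assume "\<not> annihilates Q f"
  then obtain z0 where z0: "z0 \<in> ball 0 1" "bieval Q z0 (f z0) \<noteq> 0"
    by (auto simp: annihilates_def)
  define U where "U = {z \<in> ball 0 1. bieval Q z (f z) \<noteq> 0}"
  have hol: "(\<lambda>z. bieval R z (f z)) holomorphic_on ball 0 1" for R
    by (intro holomorphic_intros f)
  have "open U"
  proof -
    have "U = ball 0 1 \<inter> (\<lambda>z. bieval Q z (f z)) -` (-{0})"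
      by (auto simp: U_def)
    thus ?thesis
      using continuous_open_preimage[OF holomorphic_on_imp_continuous_on[OF hol], of "-{0}" Q] by auto
  qed
  have "bieval P z (f z) = 0" if "z \<in> ball 0 1" for z
  proof (rule analytic_continuation_open[where s = U and s' = "ball 0 1"
         and f = "\<lambda>z. bieval P z (f z)" and g = "\<lambda>_. 0"])
    show "U \<noteq> {}" "U \<subseteq> ball 0 1" using z0 by (auto simp: U_def)
    show "bieval P w (f w) = 0" if "w \<in> U" for w
      using that PQ by (auto simp: annihilates_def U_def)
  qed (use \<open>open U\<close> hol that in auto)
  thus "annihilates P f" by (simp add: annihilates_def)
qed

text \<open>The polynomial \<open>D\<close> plays the role of a discriminant. A nonzero element \<open>E\<close> of least degree
  in the ideal generated by a minimal annihilator \<open>P\<close> and its derivative divides a multiple of \<open>P\<close>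
  by pseudo-division. Having smaller degree than \<open>P\<close>, it does not annihilate \<open>f\<close>, so by primality
  the cofactor does; the cofactor then has full degree and \<open>E\<close> is constant in \<open>w\<close>.\<close>

lemma annihilator_separable:
  assumes f: "f holomorphic_on ball 0 1" and "P0 \<noteq> 0" "annihilates P0 f"
  obtains P D B where "P \<noteq> 0" "annihilates P f" "D \<noteq> 0"
    "\<forall>z\<in>ball 0 1. poly D z = bieval B z (f z) * bieval (pderiv P) z (f z)"
proof -
  define P where "P = arg_min degree (\<lambda>P. P \<noteq> 0 \<and> annihilates P f)"
  have P: "P \<noteq> 0" "annihilates P f"
    using arg_min_natI[of "\<lambda>P. P \<noteq> 0 \<and> annihilates P f" P0 degree] assms unfolding P_def by auto
  have min: "degree P \<le> degree Q" if "Q \<noteq> 0" "annihilates Q f" for Q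
    unfolding P_def by (rule arg_min_nat_le) (use that in auto)
  have deg: "degree P \<noteq> 0"
  proof
    assume "degree P = 0"
    then obtain p where p: "P = [:p:]" by (auto elim: degree_eq_zeroE)
    have "poly p z = 0" if "z \<in> ball 0 1" for z
      using P that by (auto simp: annihilates_def p)
    hence "ball 0 1 \<subseteq> {z. poly p z = 0}" by auto
    moreover have "finite {z. poly p z = 0}"
      using P p by (intro poly_roots_finite) auto
    ultimately have "finite (ball (0::complex) 1)"
      using finite_subset by blast
    thus False
      using uncountable_ball[of 1 "0::complex"] countable_finite by auto
  qed
  define I where "I = {E. E \<noteq> 0 \<and> (\<exists>A B. E = A * P + B * pderiv P)}"
  have pd0: "pderiv P \<noteq> 0"
    using deg by (simp add: pderiv_eq_0_iff)
  have pdI: "pderiv P \<in> I"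
  proof -
    have "pderiv P = 0 * P + 1 * pderiv P" by simp
    thus ?thesis unfolding I_def using pd0 by blast
  qed
  define E where "E = arg_min degree (\<lambda>E. E \<in> I)"
  have EI: "E \<in> I"
    using arg_min_natI[of "\<lambda>E. E \<in> I" "pderiv P" degree] pdI unfolding E_def by auto
  have Emin: "degree E \<le> degree Q" if "Q \<in> I" for Q
    unfolding E_def by (rule arg_min_nat_le) (use that in auto)
  from EI obtain A B where AB: "E \<noteq> 0" "E = A * P + B * pderiv P"
    by (auto simp: I_def)
  obtain q r where qr: "pseudo_divmod P E = (q, r)" by (cases "pseudo_divmod P E")
  define c where "c = lead_coeff E ^ (Suc (degree P) - degree E)"
  have c0: "c \<noteq> 0" using AB(1) by (simp add: c_def)
  have eq: "smult c P = E * q + r"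
    using pseudo_divmod(1)[OF AB(1) qr] by (simp add: c_def)
  have "r = 0"
  proof (rule ccontr)
    assume "r \<noteq> 0"
    have "r = ([:c:] - A * q) * P + (- B * q) * pderiv P"
      using eq AB(2) by (simp add: algebra_simps)
    hence "r \<in> I" using \<open>r \<noteq> 0\<close> unfolding I_def by blast
    thus False using pseudo_divmod(2)[OF AB(1) qr] \<open>r \<noteq> 0\<close> Emin[of r] by auto
  qed
  \<comment> \<open>\<open>E\<close> lies below the minimal annihilating degree, so the cofactor \<open>q\<close> annihilates \<open>f\<close>.\<close>
  have "degree E < degree P"
    using Emin[OF pdI] deg by (simp add: degree_pderiv)
  hence "\<not> annihilates E f" using min[of E] AB(1) by auto
  moreover have "annihilates (E * q) f"
    using P(2) eq \<open>r = 0\<close> unfolding annihilates_def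
    by (metis add.right_neutral bieval_simps(5) mult_zero_right)
  ultimately have "annihilates q f"
    using annihilates_multD[OF f] by blast
  moreover have "q \<noteq> 0" using eq \<open>r = 0\<close> c0 P by auto
  ultimately have "degree P \<le> degree q" using min by blast
  moreover have "degree P = degree E + degree q"
    using eq \<open>r = 0\<close> c0 AB(1) \<open>q \<noteq> 0\<close> by (metis add.right_neutral degree_mult_eq degree_smult_eq)
  ultimately have "degree E = 0" by simp
  then obtain D where D: "E = [:D:]" by (auto elim: degree_eq_zeroE)
  show ?thesis
  proof (rule that[of P D B])
    show "D \<noteq> 0" using AB D by auto
    show "\<forall>z\<in>ball 0 1. poly D z = bieval B z (f z) * bieval (pderiv P) z (f z)"
    proof
      fix z :: complex assume z: "z \<in> ball 0 1"
    have "poly D z = bieval E z (f z)" by (simp add: D)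
    also have "\<dots> = bieval B z (f z) * bieval (pderiv P) z (f z)"
      unfolding AB(2) using P(2) z by (simp add: annihilates_def)
    finally show "poly D z = bieval B z (f z) * bieval (pderiv P) z (f z)" .
    qed
  qed (use P in auto)
qed

section \<open>Local roots of a bivariate polynomial\<close>

text \<open>A holomorphic implicit function theorem near a simple root. The simplified Newton map
  \<open>w \<mapsto> w - P(z, w) / c\<close>, where \<open>c\<close> is the derivative at the base point, is a contraction of a small
  disc around \<open>w0\<close> uniformly in \<open>z\<close>; its iterates are holomorphic in \<open>z\<close> and converge uniformly to
  the fixed point.\<close>

lemma local_root_function:
  assumes "bieval (pderiv P) z0 w0 \<noteq> 0" "bieval P z0 w0 = 0"
  obtains \<rho> \<eta> y where "\<rho> > 0" "\<eta> > 0" "y holomorphic_on ball z0 \<rho>"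
    "\<And>z w. z \<in> ball z0 \<rho> \<Longrightarrow> w \<in> ball w0 \<eta> \<Longrightarrow> bieval P z w = 0 \<Longrightarrow> w = y z"
proof -
  define c where "c = bieval (pderiv P) z0 w0"
  have c: "c \<noteq> 0" using assms by (simp add: c_def)
  define T where "T = (\<lambda>z w. w - bieval P z w / c)"
  have "((\<lambda>x. bieval (pderiv P) (fst x) (snd x)) \<longlongrightarrow> c) (nhds (z0, w0))"
    unfolding c_def by (rule tendsto_eq_intros filterlim_ident refl | simp)+
  hence "((\<lambda>x. 1 - bieval (pderiv P) (fst x) (snd x) / c) \<longlongrightarrow> 1 - c / c) (nhds (z0, w0))"
    using c by (intro tendsto_diff tendsto_divide tendsto_const)
  hence "eventually (\<lambda>x. dist (1 - bieval (pderiv P) (fst x) (snd x) / c) 0 < 1/2) (nhds (z0, w0))"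
    using c by (intro tendstoD) auto
  then obtain R where R: "R > 0"
    "\<And>x. dist x (z0,w0) < R \<Longrightarrow> norm (1 - bieval (pderiv P) (fst x) (snd x) / c) < 1/2"
    unfolding eventually_nhds_metric by auto
  define \<eta> where "\<eta> = R / 2"
  have \<eta>: "\<eta> > 0" using R by (simp add: \<eta>_def)
  have "((\<lambda>z. bieval P z w0 / c) \<longlongrightarrow> bieval P z0 w0 / c) (nhds z0)"
    using c by (intro tendsto_intros filterlim_ident) auto
  hence "eventually (\<lambda>z. dist (bieval P z w0 / c) 0 < \<eta> / 2) (nhds z0)"
    using assms \<eta> by (intro tendstoD) auto
  then obtain S where S: "S > 0" "\<And>z. dist z z0 < S \<Longrightarrow> norm (bieval P z w0 / c) < \<eta> / 2"
    unfolding eventually_nhds_metric by auto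
  define \<rho> where "\<rho> = min S \<eta>"
  have \<rho>: "\<rho> > 0" using S \<eta> by (simp add: \<rho>_def)
  have contr: "norm (T z w - T z w') \<le> 1/2 * norm (w - w')"
    if "z \<in> ball z0 \<rho>" "w \<in> cball w0 \<eta>" "w' \<in> cball w0 \<eta>" for z w w'
  proof (rule field_differentiable_bound[of "cball w0 \<eta>" "T z" "\<lambda>w. 1 - bieval (pderiv P) z w / c"])
    show "(T z has_field_derivative 1 - bieval (pderiv P) z v / c) (at v within cball w0 \<eta>)" for v
      unfolding T_def
      by (intro DERIV_diff DERIV_ident DERIV_cdivide has_field_derivative_bieval)
    fix v assume v: "v \<in> cball w0 \<eta>"
    have "dist (z, v) (z0, w0) \<le> dist z z0 + dist v w0"
      by (simp add: dist_prod_def sqrt_sum_squares_le_sum)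
    also have "\<dots> < R" using that v by (simp add: \<rho>_def \<eta>_def dist_commute)
    finally show "norm (1 - bieval (pderiv P) z v / c) \<le> 1/2"
      using R(2)[of "(z,v)"] by simp
  qed (use that in auto)
  have base: "norm (T z w0 - w0) < \<eta> / 2" if "z \<in> ball z0 \<rho>" for z
    using S(2)[of z] that by (simp add: T_def \<rho>_def dist_commute)
  have inv: "T z w \<in> cball w0 \<eta>" if "z \<in> ball z0 \<rho>" "w \<in> cball w0 \<eta>" for z w
  proof -
    have "norm (T z w - w0) \<le> norm (T z w - T z w0) + norm (T z w0 - w0)"
      by (metis diff_add_cancel add_diff_eq norm_triangle_ineq)
    also have "\<dots> \<le> 1/2 * norm (w - w0) + \<eta> / 2"
      using contr[OF that(1,2), of w0] base[OF that(1)] \<eta> by (intro add_mono) auto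
    also have "norm (w - w0) \<le> \<eta>" using that by (simp add: dist_norm norm_minus_commute)
    finally show ?thesis by (simp add: dist_norm norm_minus_commute)
  qed
  define Y where "Y = (\<lambda>n z. (T z ^^ n) w0)"
  have Yin: "Y n z \<in> cball w0 \<eta>" if "z \<in> ball z0 \<rho>" for n z
    by (induction n) (use that inv \<eta> in \<open>auto simp: Y_def\<close>)
  have Yhol: "Y n holomorphic_on ball z0 \<rho>" for n
  proof (induction n)
    case (Suc n)
    have "(\<lambda>z. Y n z - bieval P z (Y n z) / c) holomorphic_on ball z0 \<rho>"
      by (intro holomorphic_intros Suc) (use c in auto)
    thus ?case by (simp add: Y_def T_def)
  qed (simp add: Y_def)
  have "\<exists>w. w \<in> cball w0 \<eta> \<and> T z w = w" if z: "z \<in> ball z0 \<rho>" for z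
  proof -
    have "\<exists>!w\<in>cball w0 \<eta>. T z w = w"
    proof (rule Banach_fix)
      show "T z ` cball w0 \<eta> \<subseteq> cball w0 \<eta>"
        using inv[OF z] by (rule image_subsetI)
      show "dist (T z w) (T z w') \<le> 1/2 * dist w w'"
        if "w \<in> cball w0 \<eta>" "w' \<in> cball w0 \<eta>" for w w'
        unfolding dist_norm using z that by (rule contr)
      show "complete (cball w0 \<eta>)" by (intro compact_imp_complete compact_cball)
      show "cball w0 \<eta> \<noteq> {}" using \<eta> by simp
    qed simp_all
    thus ?thesis by blast
  qed
  then obtain y where y: "\<And>z. z \<in> ball z0 \<rho> \<Longrightarrow> y z \<in> cball w0 \<eta>" "\<And>z. z \<in> ball z0 \<rho> \<Longrightarrow> T z (y z) = y z"
    by metis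
  have close: "norm (Y n z - y z) \<le> (1/2)^n * \<eta>" if z: "z \<in> ball z0 \<rho>" for n z
  proof (induction n)
    case 0
    show ?case using y(1)[OF z] by (simp add: Y_def dist_norm)
  next
    case (Suc n)
    have "norm (Y (Suc n) z - y z) = norm (T z (Y n z) - T z (y z))"
      using y(2)[OF z] by (simp add: Y_def)
    also have "\<dots> \<le> 1/2 * norm (Y n z - y z)"
      by (rule contr[OF z Yin[OF z] y(1)[OF z]])
    finally show ?case using Suc by simp
  qed
  have "y holomorphic_on ball z0 \<rho>"
  proof (rule holomorphic_uniform_sequence[OF open_ball Yhol])
    fix x assume "x \<in> ball z0 \<rho>"
    then obtain d where d: "d > 0" "cball x d \<subseteq> ball z0 \<rho>"
      using open_contains_cball open_ball by blast
    have "uniform_limit (cball x d) Y y sequentially"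
    proof (rule uniform_limitI)
      fix e :: real assume e: "e > 0"
      have "(\<lambda>n. (1/2)^n * \<eta>) \<longlonglongrightarrow> 0 * \<eta>"
        by (intro tendsto_intros) auto
      hence "eventually (\<lambda>n. (1/2)^n * \<eta> < e) sequentially"
        using e by (intro order_tendstoD) auto
      thus "eventually (\<lambda>n. \<forall>z\<in>cball x d. dist (Y n z) (y z) < e) sequentially"
      proof eventually_elim
        case (elim n)
        show ?case
        proof
          fix z assume "z \<in> cball x d"
          hence "norm (Y n z - y z) \<le> (1/2)^n * \<eta>"
            using d(2) by (intro close) auto
          thus "dist (Y n z) (y z) < e"
            unfolding dist_norm using elim by (rule le_less_trans)
        qed
      qed
    qed
    with d show "\<exists>d>0. cball x d \<subseteq> ball z0 \<rho> \<and> uniform_limit (cball x d) Y y sequentially" by blast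
  qed
  moreover have "w = y z" if "z \<in> ball z0 \<rho>" "w \<in> ball w0 \<eta>" "bieval P z w = 0" for z w
  proof -
    have "T z w = w" using that by (simp add: T_def)
    hence "norm (w - y z) \<le> 1/2 * norm (w - y z)"
      using contr[OF that(1) _ y(1)[OF that(1)], of w] y(2)[OF that(1)] that(2) by simp
    hence "norm (w - y z) \<le> 0" by linarith
    thus ?thesis by simp
  qed
  ultimately show ?thesis using that \<rho> \<eta> by blast
qed

section \<open>Meromorphic extension across the unit circle\<close>

text \<open>Only values inside the disc are compared, because \<open>f\<close> stands for the sum of a power
  series, whose formal value where the series diverges carries no meaning.\<close>

definition extends_mero :: "(complex \<Rightarrow> complex) \<Rightarrow> complex \<Rightarrow> bool" where
  "extends_mero f \<zeta> \<longleftrightarrow>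
     (\<exists>g. g meromorphic_on {\<zeta>} \<and> (\<forall>\<^sub>F z in at \<zeta> within ball 0 1. f z = g z))"

text \<open>The Cauchy bound on the roots of a polynomial. Its right-hand side is continuous in \<open>z\<close>, so it
  bounds an algebraic function near every point where the leading coefficient does not vanish.\<close>

lemma bieval_root_bound:
  assumes l: "poly (lead_coeff P) z \<noteq> 0" and root: "bieval P z w = 0"
  shows "norm w \<le> 1 + (\<Sum>i<degree P. norm (poly (coeff P i) z)) / norm (poly (lead_coeff P) z)"
    (is "_ \<le> 1 + ?S / ?l")
proof (cases "norm w \<le> 1")
  case True
  have "?S / ?l \<ge> 0" by (intro divide_nonneg_nonneg sum_nonneg) auto
  with True show ?thesis by simp
next
  case False
  have deg: "degree P > 0"
  proof (rule ccontr)
    assume "\<not> degree P > 0"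
    thus False using l root by (simp add: bieval_altdef)
  qed
  have "{..degree P} = insert (degree P) {..<degree P}" by auto
  hence "poly (lead_coeff P) z * w ^ degree P = - (\<Sum>i<degree P. poly (coeff P i) z * w ^ i)"
    using root unfolding bieval_altdef by (simp add: add_eq_0_iff2)
  hence "?l * norm w ^ degree P = norm (\<Sum>i<degree P. poly (coeff P i) z * w ^ i)"
    by (metis norm_minus_cancel norm_mult norm_power)
  also have "\<dots> \<le> (\<Sum>i<degree P. norm (poly (coeff P i) z) * norm w ^ (degree P - 1))"
    using False by (intro sum_norm_le)
      (auto simp: norm_mult norm_power intro!: mult_left_mono power_increasing)
  also have "\<dots> = ?S * norm w ^ (degree P - 1)" by (simp add: sum_distrib_right)
  finally have "?l * norm w * norm w ^ (degree P - 1) \<le> ?S * norm w ^ (degree P - 1)"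
    using deg by (cases "degree P") (auto simp: mult_ac)
  moreover have "norm w ^ (degree P - 1) > 0"
    using False by (intro zero_less_power) auto
  ultimately have "?l * norm w \<le> ?S" by simp
  hence "norm w \<le> ?S / ?l" using l by (simp add: field_simps)
  thus ?thesis by simp
qed

text \<open>Because \<open>f\<close> stays bounded near \<open>\<zeta>\<close>, its values converge along some sequence in the disc
  tending to \<open>\<zeta>\<close>. The limit \<open>w0\<close> is a root of \<open>P(\<zeta>, _)\<close>, and it is simple since \<open>D(\<zeta>)\<close> is a multiple of
  the derivative there. Close to a late member of the sequence, \<open>f\<close> must coincide with the root
  function through \<open>(\<zeta>, w0)\<close>; the identity theorem spreads this over the convex set where both are
  defined.\<close>

lemma extends_mero_at_simple_point:
  assumes f: "f holomorphic_on ball 0 1" and P: "annihilates P f"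
    and D: "\<And>z. z \<in> ball 0 1 \<Longrightarrow> poly D z = bieval B z (f z) * bieval (pderiv P) z (f z)"
    and \<zeta>: "norm \<zeta> = 1" "poly (lead_coeff P) \<zeta> \<noteq> 0" "poly D \<zeta> \<noteq> 0"
  shows "extends_mero f \<zeta>"
proof -
  \<comment> \<open>Points approaching \<open>\<zeta>\<close> along the radius; the first one is the origin.\<close>
  define z where "z = (\<lambda>n. of_real (1 - inverse (real (Suc n))) * \<zeta>)"
  have zin: "z n \<in> ball 0 1" for n
  proof -
    have "norm (z n) = \<bar>1 - inverse (real (Suc n))\<bar>"
      unfolding z_def norm_mult norm_of_real using \<zeta> by simp
    also have "\<dots> < 1" by (simp add: field_simps)
    finally show ?thesis by simp
  qed
  have zlim: "z \<longlonglongrightarrow> \<zeta>"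
  proof -
    have "z \<longlonglongrightarrow> of_real (1 - 0) * \<zeta>"
      unfolding z_def by (intro tendsto_intros LIMSEQ_inverse_real_of_nat)
    thus ?thesis by simp
  qed
  define b where "b = (\<lambda>z. 1 + (\<Sum>i<degree P. norm (poly (coeff P i) z)) / norm (poly (lead_coeff P) z))"
  have "(\<lambda>n. b (z n)) \<longlonglongrightarrow> b \<zeta>"
    unfolding b_def using \<zeta> by (intro tendsto_intros zlim) auto
  hence "eventually (\<lambda>n. b (z n) < b \<zeta> + 1) sequentially"
    by (rule order_tendstoD) auto
  moreover have "(\<lambda>n. poly (lead_coeff P) (z n)) \<longlonglongrightarrow> poly (lead_coeff P) \<zeta>"
    by (intro tendsto_intros zlim)
  hence "eventually (\<lambda>n. poly (lead_coeff P) (z n) \<noteq> 0) sequentially"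
    using \<zeta>(2) by (rule tendsto_imp_eventually_ne)
  ultimately have "eventually (\<lambda>n. norm (f (z n)) \<le> b \<zeta> + 1) sequentially"
  proof eventually_elim
    case (elim n)
    have "norm (f (z n)) \<le> b (z n)"
      unfolding b_def by (rule bieval_root_bound) (use elim P zin in \<open>auto simp: annihilates_def\<close>)
    thus ?case using elim by simp
  qed
  then obtain N where N: "\<And>n. n \<ge> N \<Longrightarrow> norm (f (z n)) \<le> b \<zeta> + 1"
    unfolding eventually_sequentially by blast
  have bounded: "\<forall>n. f (z (n + N)) \<in> cball 0 (b \<zeta> + 1)" using N by simp
  obtain w0 s where s: "strict_mono s" "((\<lambda>n. f (z (n + N))) \<circ> s) \<longlonglongrightarrow> w0"
    by (rule seq_compactE[OF compact_imp_seq_compact[OF compact_cball] bounded])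
  define u where "u = (\<lambda>n. z (s n + N))"
  have uin: "u n \<in> ball 0 1" for n unfolding u_def by (rule zin)
  have ulim: "u \<longlonglongrightarrow> \<zeta>"
  proof -
    have "((\<lambda>n. z (n + N)) \<circ> s) \<longlonglongrightarrow> \<zeta>"
      by (intro LIMSEQ_subseq_LIMSEQ s LIMSEQ_ignore_initial_segment zlim)
    thus ?thesis by (simp add: u_def o_def)
  qed
  have fu: "(\<lambda>n. f (u n)) \<longlonglongrightarrow> w0"
    using s(2) by (simp add: u_def o_def)
  have "(\<lambda>n. bieval P (u n) (f (u n))) \<longlonglongrightarrow> bieval P \<zeta> w0"
    by (intro tendsto_intros ulim fu)
  hence root: "bieval P \<zeta> w0 = 0"
    using uin P by (simp add: annihilates_def LIMSEQ_const_iff)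
  have "(\<lambda>n. bieval B (u n) (f (u n)) * bieval (pderiv P) (u n) (f (u n)))
          \<longlonglongrightarrow> bieval B \<zeta> w0 * bieval (pderiv P) \<zeta> w0"
    by (intro tendsto_intros ulim fu)
  moreover have "(\<lambda>n. poly D (u n)) \<longlonglongrightarrow> poly D \<zeta>"
    by (intro tendsto_intros ulim)
  ultimately have "poly D \<zeta> = bieval B \<zeta> w0 * bieval (pderiv P) \<zeta> w0"
    using D uin by (auto intro: LIMSEQ_unique)
  hence simple: "bieval (pderiv P) \<zeta> w0 \<noteq> 0"
    using \<zeta> by auto
  obtain \<rho> \<eta> y where y: "\<rho> > 0" "\<eta> > 0" "y holomorphic_on ball \<zeta> \<rho>"
    "\<And>z w. z \<in> ball \<zeta> \<rho> \<Longrightarrow> w \<in> ball w0 \<eta> \<Longrightarrow> bieval P z w = 0 \<Longrightarrow> w = y z"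
    using local_root_function[OF simple root] by blast
  define U where "U = ball \<zeta> \<rho> \<inter> ball 0 1"
  define V where "V = U \<inter> f -` ball w0 \<eta>"
  have "open V"
    unfolding V_def U_def
    by (intro continuous_open_preimage holomorphic_on_imp_continuous_on
          holomorphic_on_subset[OF f]) auto
  have "eventually (\<lambda>n. dist (u n) \<zeta> < \<rho>) sequentially" "eventually (\<lambda>n. dist (f (u n)) w0 < \<eta>) sequentially"
    using tendstoD[OF ulim] tendstoD[OF fu] y by auto
  hence "eventually (\<lambda>n. u n \<in> V) sequentially"
    by eventually_elim (use uin in \<open>auto simp: V_def U_def dist_commute\<close>)
  hence "\<exists>n. u n \<in> V" by (rule eventually_happens'[OF sequentially_bot])
  hence "V \<noteq> {}" by blast
  have eq: "f x = y x" if "x \<in> U" for x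
  proof (rule analytic_continuation_open[OF \<open>open V\<close> _ \<open>V \<noteq> {}\<close>, of U f y])
    show "connected U"
      unfolding U_def by (intro convex_connected convex_Int convex_ball)
    show "f holomorphic_on U" "y holomorphic_on U"
      by (rule holomorphic_on_subset[OF f] holomorphic_on_subset[OF y(3)], simp add: U_def)+
    show "f v = y v" if "v \<in> V" for v
      using that y(4) P by (auto simp: V_def U_def annihilates_def)
  qed (use that in \<open>auto simp: U_def V_def\<close>)
  have "y meromorphic_on {\<zeta>}"
    using y by (intro analytic_on_imp_meromorphic_on) (auto simp: analytic_at_ball)
  moreover have "\<forall>\<^sub>F z in at \<zeta> within ball 0 1. f z = y z"
    unfolding eventually_at using y(1) eq
    by (intro exI[of _ \<rho>] conjI ballI impI) (auto simp: U_def dist_commute)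
  ultimately show ?thesis unfolding extends_mero_def by blast
qed

lemma extends_mero_cofinite:
  assumes f: "f holomorphic_on ball 0 1" and "P0 \<noteq> 0" "annihilates P0 f"
  obtains X where "finite X" "\<forall>\<zeta>. norm \<zeta> = 1 \<longrightarrow> \<zeta> \<notin> X \<longrightarrow> extends_mero f \<zeta>"
proof -
  obtain P D B where
    P: "P \<noteq> 0" "annihilates P f" "D \<noteq> 0" and
    D: "\<forall>z\<in>ball 0 1. poly D z = bieval B z (f z) * bieval (pderiv P) z (f z)"
    by (rule annihilator_separable[OF assms])
  show ?thesis
  proof (rule that[of "{z. poly (lead_coeff P) z = 0} \<union> {z. poly D z = 0}"])
    show "finite ({z. poly (lead_coeff P) z = 0} \<union> {z. poly D z = 0})"
      using P by (auto intro: poly_roots_finite)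
    have "extends_mero f \<zeta>"
      if "norm \<zeta> = 1" "\<zeta> \<notin> {z. poly (lead_coeff P) z = 0} \<union> {z. poly D z = 0}" for \<zeta>
      by (rule extends_mero_at_simple_point[OF f P(2) D[rule_format] that(1)]) (use that(2) in simp_all)
    thus "\<forall>\<zeta>. norm \<zeta> = 1 \<longrightarrow> \<zeta> \<notin> {z. poly (lead_coeff P) z = 0} \<union> {z. poly D z = 0}
            \<longrightarrow> extends_mero f \<zeta>"
      by blast
  qed
qed

lemma extends_mero_pullback:
  assumes "extends_mero f (\<zeta> ^ K)" "K > 0" "norm \<zeta> = 1"
  shows "extends_mero (\<lambda>z. f (z ^ K)) \<zeta>"
proof -
  obtain g where g: "g meromorphic_on {\<zeta> ^ K}" "\<forall>\<^sub>F z in at (\<zeta> ^ K) within ball 0 1. f z = g z"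
    using assms unfolding extends_mero_def by blast
  have "(\<lambda>z. g (z ^ K)) meromorphic_on {\<zeta>}"
    by (rule meromorphic_on_compose[OF g(1)]) (auto intro!: analytic_intros)
  moreover have "filterlim (\<lambda>z. z ^ K) (at (\<zeta> ^ K) within ball 0 1) (at \<zeta> within ball 0 1)"
    unfolding filterlim_at
  proof
    show "\<forall>\<^sub>F z in at \<zeta> within ball 0 1. z ^ K \<in> ball 0 1 \<and> z ^ K \<noteq> \<zeta> ^ K"
      unfolding eventually_at_filter
    proof (intro always_eventually allI impI)
      fix z :: complex assume "z \<in> ball 0 1"
      hence "norm (z ^ K) < 1"
        using assms by (simp add: norm_power power_less_one_iff)
      moreover have "norm (\<zeta> ^ K) = 1" using assms by (simp add: norm_power)
      ultimately show "z ^ K \<in> ball 0 1 \<and> z ^ K \<noteq> \<zeta> ^ K" by auto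
    qed
  qed (intro tendsto_intros)
  hence "\<forall>\<^sub>F z in at \<zeta> within ball 0 1. f (z ^ K) = g (z ^ K)"
    by (rule eventually_compose_filterlim[OF g(2)])
  ultimately show ?thesis unfolding extends_mero_def by blast
qed

text \<open>The branch of the \<open>K\<close>-th root that sends \<open>\<zeta> ^ K\<close> to \<open>\<zeta>\<close> is analytic there and maps nonzero
  points of the disc into the disc.\<close>

lemma extends_mero_pushforward:
  assumes "extends_mero (\<lambda>z. f (z ^ K)) \<zeta>" "K > 0" "norm \<zeta> = 1"
  shows "extends_mero f (\<zeta> ^ K)"
proof -
  obtain g where g: "g meromorphic_on {\<zeta>}" "\<forall>\<^sub>F z in at \<zeta> within ball 0 1. f (z ^ K) = g z"
    using assms unfolding extends_mero_def by blast
  have \<zeta>0: "\<zeta> \<noteq> 0" using assms by auto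
  \<comment> \<open>Dividing by \<open>\<zeta> ^ K\<close> moves the base point to 1, away from the branch cut of \<open>Ln\<close>.\<close>
  define r where "r = (\<lambda>u. \<zeta> * exp (Ln (u / \<zeta> ^ K) / of_nat K))"
  have rK: "r u ^ K = u" if "u \<noteq> 0" for u
    using that \<zeta>0 assms(2) by (simp add: r_def power_mult_distrib flip: exp_of_nat_mult)
  have r\<zeta>: "r (\<zeta> ^ K) = \<zeta>" using \<zeta>0 by (simp add: r_def)
  have ran: "r analytic_on {\<zeta> ^ K}"
    unfolding r_def using \<zeta>0 assms(2) by (auto intro!: analytic_intros)
  have "(\<lambda>u. g (r u)) meromorphic_on {\<zeta> ^ K}"
    by (rule meromorphic_on_compose[OF g(1) ran]) (auto simp: r\<zeta>)
  moreover have ev0: "\<forall>\<^sub>F u in at (\<zeta> ^ K) within ball 0 1. u \<noteq> 0"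
    using \<zeta>0 tendsto_imp_eventually_ne[OF tendsto_ident_at[of "\<zeta> ^ K" "ball 0 1"]] by simp
  have "filterlim r (at \<zeta> within ball 0 1) (at (\<zeta> ^ K) within ball 0 1)"
    unfolding filterlim_at
  proof
    have "isCont r (\<zeta> ^ K)"
      using ran by (simp add: analytic_at_imp_isCont)
    thus "(r \<longlongrightarrow> \<zeta>) (at (\<zeta> ^ K) within ball 0 1)"
      using r\<zeta> by (metis continuous_within continuous_at_imp_continuous_at_within)
    have "\<forall>\<^sub>F u in at (\<zeta> ^ K) within ball 0 1. u \<in> ball 0 1"
      by (simp add: eventually_at_filter)
    with ev0 show "\<forall>\<^sub>F u in at (\<zeta> ^ K) within ball 0 1. r u \<in> ball 0 1 \<and> r u \<noteq> \<zeta>"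
    proof eventually_elim
      case (elim u)
      have "norm (r u) ^ K < 1"
        using rK[of u] elim by (simp flip: norm_power)
      hence "norm (r u) < 1"
        using assms(2) by (simp add: power_less_one_iff)
      thus ?case using assms(3) by auto
    qed
  qed
  hence "\<forall>\<^sub>F u in at (\<zeta> ^ K) within ball 0 1. f (r u ^ K) = g (r u)"
    by (rule eventually_compose_filterlim[OF g(2)])
  with ev0 have "\<forall>\<^sub>F u in at (\<zeta> ^ K) within ball 0 1. f u = g (r u)"
    by eventually_elim (simp add: rK)
  ultimately show ?thesis unfolding extends_mero_def by blast
qed

section \<open>Transport along the Mahler equation\<close>

lemma extends_mero_mahler_step:
  assumes eqn: "\<And>z. z \<in> ball 0 1 \<Longrightarrow> (\<Sum>i\<le>d. poly (a i) z * f (z ^ (k ^ i))) = 0"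
    and ad: "a d \<noteq> 0" and k: "k > 0" and \<zeta>: "norm \<zeta> = 1"
    and ext: "\<And>i. i < d \<Longrightarrow> extends_mero f (\<zeta> ^ (k ^ i))"
  shows "extends_mero f (\<zeta> ^ (k ^ d))"
proof (rule extends_mero_pushforward)
  have "\<exists>g. g meromorphic_on {\<zeta>} \<and> (\<forall>\<^sub>F z in at \<zeta> within ball 0 1. f (z ^ (k ^ i)) = g z)" if "i < d" for i
    using extends_mero_pullback[OF ext[OF that]] k \<zeta> unfolding extends_mero_def by auto
  then obtain g where g: "\<And>i. i < d \<Longrightarrow> g i meromorphic_on {\<zeta>}"
    "\<And>i. i < d \<Longrightarrow> \<forall>\<^sub>F z in at \<zeta> within ball 0 1. f (z ^ (k ^ i)) = g i z"
    by metis
  define G where "G = (\<lambda>z. - (\<Sum>i<d. poly (a i) z * g i z) / poly (a d) z)"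
  have pm: "poly p meromorphic_on {\<zeta>}" for p :: "complex poly"
    unfolding poly_altdef by (intro analytic_on_imp_meromorphic_on analytic_intros)
  have "G meromorphic_on {\<zeta>}"
    unfolding G_def by (intro meromorphic_intros g pm) auto
  moreover have "\<forall>\<^sub>F z in at \<zeta> within ball 0 1. f (z ^ (k ^ d)) = G z"
  proof -
    have "finite {z. poly (a d) z = 0}" using ad by (rule poly_roots_finite)
    hence "\<forall>\<^sub>F z in at \<zeta>. z \<notin> {z. poly (a d) z = 0}"
      by (metis islimpt_finite islimpt_iff_eventually)
    hence nz: "\<forall>\<^sub>F z in at \<zeta> within ball 0 1. poly (a d) z \<noteq> 0"
      by (auto simp: eventually_at_filter elim: eventually_mono)
    have "\<forall>\<^sub>F z in at \<zeta> within ball 0 1. \<forall>i\<in>{..<d}. f (z ^ (k ^ i)) = g i z"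
      using g(2) by (intro eventually_ball_finite) auto
    moreover have "\<forall>\<^sub>F z in at \<zeta> within ball 0 1. z \<in> ball 0 1"
      by (simp add: eventually_at_filter)
    ultimately show ?thesis using nz
    proof eventually_elim
      case (elim z)
      have "{..d} = insert d {..<d}" by auto
      hence "poly (a d) z * f (z ^ (k ^ d)) = - (\<Sum>i<d. poly (a i) z * g i z)"
        using eqn[OF elim(2)] elim(1) by (simp add: add_eq_0_iff2)
      thus ?case using elim(3) by (simp add: G_def field_simps)
    qed
  qed
  ultimately show "extends_mero (\<lambda>z. f (z ^ (k ^ d))) \<zeta>"
    unfolding extends_mero_def by blast
qed (use k \<zeta> in auto)

text \<open>Write \<open>e n\<close> for \<open>exp(2 pi i / k ^ n)\<close>, so that the \<open>k\<close>-th power of \<open>e (n + 1)\<close> is \<open>e n\<close> and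
  \<open>e 0 = 1\<close>. Since \<open>e n\<close> tends to 1 through points other than 1, it leaves the finite set \<open>X\<close>; from
  there the Mahler step at \<open>e (n + d)\<close> descends to \<open>e n\<close>.\<close>

lemma extends_mero_at_one:
  assumes k: "k \<ge> 2"
    and eqn: "\<And>z. z \<in> ball 0 1 \<Longrightarrow> (\<Sum>i\<le>d. poly (a i) z * f (z ^ (k ^ i))) = 0"
    and ad: "a d \<noteq> 0"
    and X: "finite X" "\<And>\<zeta>. norm \<zeta> = 1 \<Longrightarrow> \<zeta> \<notin> X \<Longrightarrow> extends_mero f \<zeta>"
  shows "extends_mero f 1"
proof -
  define e where "e = (\<lambda>n. cis (2 * pi / real k ^ n))"
  have e1: "norm (e n) = 1" for n by (simp add: e_def)
  have epow: "e (n + i) ^ (k ^ i) = e n" for n i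
    using k unfolding e_def by (subst Complex.DeMoivre) (simp add: power_add)
  have "filterlim e (at 1) sequentially"
    unfolding filterlim_at
  proof
    have "(\<lambda>n. 2 * pi * inverse (real k) ^ n) \<longlonglongrightarrow> 2 * pi * 0"
      using k by (intro tendsto_intros LIMSEQ_power_zero) (auto simp: field_simps)
    hence "(\<lambda>n. cis (2 * pi * inverse (real k) ^ n)) \<longlonglongrightarrow> cis 0"
      by (intro tendsto_intros) auto
    thus "e \<longlonglongrightarrow> 1" by (simp add: e_def field_simps power_inverse)
    show "\<forall>\<^sub>F n in sequentially. e n \<in> UNIV \<and> e n \<noteq> 1"
      using eventually_gt_at_top[of 0]
    proof eventually_elim
      case (elim n)
      \<comment> \<open>From \<open>k ^ n \<ge> 2\<close> the angle lies in \<open>(0, pi]\<close>, where it is the principal argument.\<close>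
      have "2 ^ 1 \<le> (2::real) ^ n" using elim by (intro power_increasing) auto
      also have "\<dots> \<le> real k ^ n" using k by (intro power_mono) auto
      finally have "real k ^ n \<ge> 2" by simp
      hence pos: "0 < 2 * pi / real k ^ n" using k by (intro divide_pos_pos) auto
      have "2 * pi / real k ^ n \<le> 2 * pi / 2"
        using \<open>real k ^ n \<ge> 2\<close> k by (intro divide_left_mono) auto
      hence "Arg (e n) = 2 * pi / real k ^ n"
        unfolding e_def using pos by (intro Arg_cis) auto
      with pos have "Arg (e n) \<noteq> Arg 1" by (metis Arg_1 less_irrefl)
      thus ?case by auto
    qed
  qed
  moreover have "\<forall>\<^sub>F z in at 1. z \<notin> X"
    using X(1) by (metis islimpt_finite islimpt_iff_eventually)
  ultimately have "\<forall>\<^sub>F n in sequentially. e n \<notin> X"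
    by (rule eventually_compose_filterlim[rotated])
  then obtain N where N: "\<And>n. n \<ge> N \<Longrightarrow> extends_mero f (e n)"
    using X(2) e1 unfolding eventually_sequentially by blast
  have "extends_mero f (e n)" for n
  proof (induction "N - n" arbitrary: n rule: less_induct)
    case less
    show ?case
    proof (cases "n \<ge> N")
      case False
      have "extends_mero f (e (n + d) ^ (k ^ d))"
      proof (rule extends_mero_mahler_step[where d = d and a = a, OF eqn])
        fix i assume i: "i < d"
        have "e (n + d) ^ (k ^ i) = e (n + (d - i))"
          using epow[of "n + (d - i)" i] i by simp
        moreover have "extends_mero f (e (n + (d - i)))"
          using less[of "n + (d - i)"] False i by auto
        ultimately show "extends_mero f (e (n + d) ^ (k ^ i))" by simp
      qed (use ad k e1 in auto)
      thus ?thesis by (simp add: epow)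
    qed (use N in auto)
  qed
  from this[of 0] show ?thesis by (simp add: e_def)
qed

section \<open>From power series identities to functional equations\<close>

lemma has_fps_expansion_poly: "poly p has_fps_expansion fps_of_poly (p :: complex poly)"
  by (simp add: has_fps_expansion_def)

lemma holomorphic_on_unit_disc_eval_fps:
  fixes F :: "complex fps"
  assumes "fps_conv_radius F \<ge> 1"
  shows "eval_fps F holomorphic_on ball 0 1"
proof (rule holomorphic_on_eval_fps)
  show "ball (0 :: complex) 1 \<subseteq> eball 0 (fps_conv_radius F)"
  proof
    fix z :: complex assume "z \<in> ball 0 1"
    hence "ereal (norm z) < 1" by simp
    also note assms
    finally show "z \<in> eball 0 (fps_conv_radius F)" by (simp add: in_eball_iff)
  qed
qed

lemma has_fps_expansion_0_on_unit_disc: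
  assumes "f has_fps_expansion 0" "f holomorphic_on ball 0 1" "z \<in> ball 0 1"
  shows "f z = 0"
  by (rule has_fps_expansion_0_analytic_continuation[OF assms(1,2)]) (use assms in auto)

lemma mahler_functional_equation:
  assumes "mahler_equation k d a F" "fps_conv_radius F \<ge> 1" "k \<ge> 2" "z \<in> ball 0 1"
  shows "(\<Sum>i\<le>d. poly (a i) z * eval_fps F (z ^ (k ^ i))) = 0"
proof (rule has_fps_expansion_0_on_unit_disc[OF _ _ assms(4)])
  have R: "fps_conv_radius F > 0" by (rule less_le_trans[OF _ assms(2)]) simp
  have "(eval_fps F \<circ> (\<lambda>z. z ^ (k ^ i))) has_fps_expansion (F oo fps_X ^ (k ^ i))" for i
    using assms(3)
    by (intro has_fps_expansion_compose eval_fps_has_fps_expansion R has_fps_expansion_power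
        has_fps_expansion_fps_X) auto
  hence "(\<lambda>z. \<Sum>i\<le>d. poly (a i) z * eval_fps F (z ^ (k ^ i)))
          has_fps_expansion (\<Sum>i\<le>d. fps_of_poly (a i) * (F oo fps_X ^ (k ^ i)))"
    by (intro has_fps_expansion_sum has_fps_expansion_mult has_fps_expansion_poly) (simp add: o_def)
  thus "(\<lambda>z. \<Sum>i\<le>d. poly (a i) z * eval_fps F (z ^ (k ^ i))) has_fps_expansion 0"
    using assms(1) by (simp add: mahler_equation_def)
  have "(\<lambda>z. eval_fps F (z ^ K)) holomorphic_on ball 0 1" if "K > 0" for K
  proof -
    have "eval_fps F \<circ> (\<lambda>z. z ^ K) holomorphic_on ball 0 1"
      by (rule holomorphic_on_compose_gen[OF _ holomorphic_on_unit_disc_eval_fps[OF assms(2)]])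
        (use that in \<open>auto intro!: holomorphic_intros simp: norm_power power_less_one_iff\<close>)
    thus ?thesis by (simp add: o_def)
  qed
  thus "(\<lambda>z. \<Sum>i\<le>d. poly (a i) z * eval_fps F (z ^ (k ^ i))) holomorphic_on ball 0 1"
    using assms(3) by (intro holomorphic_intros) auto
qed

text \<open>Clearing denominators turns a relation over the rational functions into one over the
  polynomials, which then holds pointwise on the disc.\<close>

lemma annihilator_of_algebraic:
  assumes "\<not> transcendental_fps F" and R: "fps_conv_radius F \<ge> 1"
  obtains P where "P \<noteq> 0" "annihilates P (eval_fps F)"
proof -
  define emb where "emb = (\<lambda>p::complex poly. fps_to_fls (fps_of_poly p))"
  have emb_mult: "emb (p * q) = emb p * emb q" for p q
    by (simp add: emb_def fps_of_poly_mult fls_times_fps_to_fls)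
  have emb_1: "emb 1 = 1" by (simp add: emb_def)
  have emb_prod: "emb (prod q A) = (\<Prod>x\<in>A. emb (q x))" for q :: "nat \<Rightarrow> _" and A
    by (induction A rule: infinite_finite_induct) (auto simp: emb_mult emb_1)
  have emb_0_iff: "emb p = 0 \<longleftrightarrow> p = 0" for p
    by (simp add: emb_def)
  obtain Q where Q: "Q \<noteq> 0" "\<And>i. coeff Q i \<in> rational_fls" "poly Q (fps_to_fls F) = 0"
    using assms(1) by (auto simp: transcendental_fps_def)
  have "\<exists>p q. q \<noteq> 0 \<and> coeff Q i = emb p / emb q" for i
    using Q(2)[of i] by (auto simp: rational_fls_def emb_def)
  then obtain p q where pq: "\<And>i. q i \<noteq> 0" "\<And>i. coeff Q i = emb (p i) / emb (q i)"
    by metis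
  define n where "n = degree Q"
  \<comment> \<open>The numerator of the \<open>i\<close>-th coefficient over the common denominator.\<close>
  define c where "c = (\<lambda>i. p i * (\<Prod>j\<in>{..n}-{i}. q j))"
  have c: "emb (c i) = emb (\<Prod>j\<le>n. q j) * coeff Q i" if "i \<le> n" for i
  proof -
    have "(\<Prod>j\<le>n. q j) = q i * (\<Prod>j\<in>{..n}-{i}. q j)"
      using that by (intro prod.remove) auto
    thus ?thesis using pq by (simp add: c_def emb_mult emb_0_iff)
  qed
  define P where "P = (\<Sum>i\<le>n. monom (c i) i)"
  have coeff_P: "coeff P i = (if i \<le> n then c i else 0)" for i
    by (simp add: P_def coeff_sum)
  have "emb (c n) \<noteq> 0"
    using c[of n] Q(1) pq(1) by (simp add: emb_0_iff n_def)
  hence "P \<noteq> 0" using coeff_P[of n] by (auto simp: emb_0_iff)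
  have "fps_to_fls (\<Sum>i\<le>n. fps_of_poly (c i) * F ^ i) = (\<Sum>i\<le>n. emb (c i) * fps_to_fls F ^ i)"
  proof -
    have "fps_to_fls (sum g A) = (\<Sum>x\<in>A. fps_to_fls (g x))" for g :: "nat \<Rightarrow> complex fps" and A
      by (induction A rule: infinite_finite_induct) auto
    thus ?thesis by (simp add: emb_def fls_times_fps_to_fls fps_to_fls_power)
  qed
  also have "\<dots> = emb (\<Prod>j\<le>n. q j) * poly Q (fps_to_fls F)"
    unfolding poly_altdef n_def[symmetric] sum_distrib_left
    by (intro sum.cong) (auto simp: c)
  finally have eq0: "(\<Sum>i\<le>n. fps_of_poly (c i) * F ^ i) = 0" using Q(3) by simp
  have bi: "bieval P z w = (\<Sum>i\<le>n. poly (c i) z * w ^ i)" for z w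
    unfolding P_def bieval_def by (simp add: poly_sum poly_monom)
  have "fps_conv_radius F > 0" by (rule less_le_trans[OF _ R]) simp
  hence "(\<lambda>z. \<Sum>i\<le>n. poly (c i) z * eval_fps F z ^ i)
           has_fps_expansion (\<Sum>i\<le>n. fps_of_poly (c i) * F ^ i)"
    by (intro has_fps_expansion_sum has_fps_expansion_mult has_fps_expansion_poly
        has_fps_expansion_power eval_fps_has_fps_expansion)
  hence "(\<lambda>z. bieval P z (eval_fps F z)) has_fps_expansion 0"
    unfolding bi eq0 .
  moreover have "(\<lambda>z. bieval P z (eval_fps F z)) holomorphic_on ball 0 1"
    by (intro holomorphic_intros holomorphic_on_unit_disc_eval_fps R)
  ultimately have "annihilates P (eval_fps F)"
    unfolding annihilates_def
    by (intro ballI) (rule has_fps_expansion_0_on_unit_disc[of "\<lambda>z. bieval P z (eval_fps F z)"])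
  thus ?thesis using that \<open>P \<noteq> 0\<close> by blast
qed

section \<open>Radial behaviour under dilation by \<open>k\<close>\<close>

lemma filterlim_power_at_left_1:
  assumes "k > 0"
  shows "filterlim (\<lambda>x::real. x ^ k) (at_left 1) (at_left 1)"
  unfolding filterlim_at
proof
  have "((\<lambda>x::real. x ^ k) \<longlongrightarrow> 1 ^ k) (at_left 1)"
    by (intro tendsto_intros)
  thus "((\<lambda>x::real. x ^ k) \<longlongrightarrow> 1) (at_left 1)" by simp
  show "\<forall>\<^sub>F x::real in at_left 1. x ^ k \<in> {..<1} \<and> x ^ k \<noteq> 1"
    using eventually_at_left_real[of 0 1, simplified]
  proof eventually_elim
    case (elim x)
    hence "x ^ k < 1" using assms by (simp add: power_less_one_iff)
    thus ?case by simp
  qed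
qed

lemma filterlim_of_real_at_left_1:
  "filterlim (of_real :: real \<Rightarrow> complex) (at 1 within ball 0 1) (at_left 1)"
  unfolding filterlim_at
proof
  have "((of_real :: real \<Rightarrow> complex) \<longlongrightarrow> of_real 1) (at_left 1)"
    by (intro tendsto_intros)
  thus "((of_real :: real \<Rightarrow> complex) \<longlongrightarrow> 1) (at_left 1)" by simp
  show "\<forall>\<^sub>F x in at_left 1. complex_of_real x \<in> ball 0 1 \<and> complex_of_real x \<noteq> 1"
    using eventually_at_left_real[of 0 1, simplified] by eventually_elim auto
qed

lemma tendsto_geometric_sum_at_left_1:
  "((\<lambda>x::real. \<Sum>i<k. x ^ i) \<longlongrightarrow> real k) (at_left 1)"
proof -
  have "((\<lambda>x::real. \<Sum>i<k. x ^ i) \<longlongrightarrow> (\<Sum>i<k. 1 ^ i)) (at_left 1)"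
    by (intro tendsto_intros)
  thus ?thesis by simp
qed

text \<open>Near 1, \<open>g(z) = u(z) (z - 1) ^ n\<close> with \<open>u(1) \<noteq> 0\<close>, and \<open>(x ^ k - 1) / (x - 1)\<close> is a
  geometric sum tending to \<open>k\<close>.\<close>

lemma meromorphic_dilation_ratio:
  assumes g: "g meromorphic_on {1}" and nz: "\<exists>\<^sub>F z in at 1. g z \<noteq> 0" and k: "k \<ge> 2"
  obtains n :: int where
    "((\<lambda>x::real. g (of_real (x ^ k)) / g (of_real x)) \<longlongrightarrow> of_nat k powi n) (at_left 1)"
proof -
  define n where "n = zorder g 1"
  define u where "u = zor_poly g 1"
  have "u 1 \<noteq> 0 \<and> (\<exists>r. r>0 \<and> u holomorphic_on cball 1 r
    \<and> (\<forall>w\<in>cball 1 r - {1}. g w  = u w * (w-1) powi n \<and> u w \<noteq>0))"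
    unfolding n_def u_def using g nz by (intro zorder_exist) (auto simp: meromorphic_at_iff)
  then obtain r where r: "u 1 \<noteq> 0" "r > 0" "u holomorphic_on cball 1 r"
    "\<And>w. w \<in> cball 1 r - {1} \<Longrightarrow> g w = u w * (w - 1) powi n"
    "\<And>w. w \<in> cball 1 r - {1} \<Longrightarrow> u w \<noteq> 0"
    by blast
  have lim1: "((of_real :: real \<Rightarrow> complex) \<longlongrightarrow> 1) (at_left 1)"
    using filterlim_of_real_at_left_1 by (simp add: filterlim_at)
  have lim2: "((\<lambda>x::real. of_real (x ^ k) :: complex) \<longlongrightarrow> 1) (at_left 1)"
    using filterlim_compose[OF lim1 filterlim_power_at_left_1] k by simp
  have "isCont u 1"
    using r(2,3) by (intro continuous_on_interior[of "cball 1 r"] holomorphic_on_imp_continuous_on) auto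
  hence ulim: "((\<lambda>x. u (s x)) \<longlongrightarrow> u 1) (at_left 1)" if "(s \<longlongrightarrow> 1) (at_left 1)" for s :: "real \<Rightarrow> complex"
    using that by (rule isCont_tendsto_compose)
  define q where "q = (\<lambda>x::real. \<Sum>i<k. x ^ i)"
  have "((\<lambda>x. u (of_real (x ^ k)) / u (of_real x) * of_real (q x) powi n)
          \<longlongrightarrow> u 1 / u 1 * of_real (real k) powi n) (at_left 1)"
    unfolding q_def using r(1) k
    by (intro tendsto_intros ulim lim1 lim2 tendsto_geometric_sum_at_left_1) auto
  hence "((\<lambda>x. u (of_real (x ^ k)) / u (of_real x) * of_real (q x) powi n)
          \<longlongrightarrow> of_nat k powi n) (at_left 1)"
    using r(1) by simp
  moreover have "\<forall>\<^sub>F x in at_left 1. u (of_real (x ^ k)) / u (of_real x) * of_real (q x) powi n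
      = g (of_real (x ^ k)) / g (of_real x)"
  proof -
    have "\<forall>\<^sub>F x in at_left 1. dist (complex_of_real x) 1 < r"
      "\<forall>\<^sub>F x in at_left 1. dist (complex_of_real (x ^ k)) 1 < r"
      using tendstoD[OF lim1 r(2)] tendstoD[OF lim2 r(2)] by auto
    moreover have "\<forall>\<^sub>F x::real in at_left 1. x \<in> {0<..<1}"
      by (rule eventually_at_left_real) auto
    ultimately show ?thesis
    proof eventually_elim
      case (elim x)
      have "x ^ k < 1" using elim k by (simp add: power_less_one_iff)
      have x: "complex_of_real x \<in> cball 1 r - {1}" "complex_of_real (x ^ k) \<in> cball 1 r - {1}"
        using elim \<open>x ^ k < 1\<close> by (auto simp: dist_commute simp del: of_real_power)
      have "x ^ k - 1 = q x * (x - 1)"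
        using one_diff_power_eq[of x k] by (simp add: q_def algebra_simps)
      hence "complex_of_real (x ^ k) - 1 = of_real (q x) * (of_real x - 1)"
        by (metis of_real_1 of_real_diff of_real_mult)
      hence "g (of_real (x ^ k)) = u (of_real (x ^ k)) * (of_real (q x) powi n * (of_real x - 1) powi n)"
        using r(4)[OF x(2)] by (simp add: power_int_mult_distrib)
      moreover have "(complex_of_real x - 1) powi n \<noteq> 0"
        using x(1) by simp
      moreover have "a / b * c = (a * (c * e)) / (b * e)" if "e \<noteq> 0" for a b c e :: complex
        using that by simp
      ultimately show ?case unfolding r(4)[OF x(1)] by metis
    qed
  qed
  ultimately have "((\<lambda>x::real. g (of_real (x ^ k)) / g (of_real x)) \<longlongrightarrow> of_nat k powi n) (at_left 1)"
    by (rule Lim_transform_eventually)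
  thus ?thesis by (rule that)
qed

text \<open>Replacing \<open>x\<close> by \<open>x ^ k\<close> leaves \<open>C\<close> unchanged and multiplies \<open>1 - x\<close> by a factor tending to
  \<open>k\<close>, so the power of \<open>1 - x\<close> contributes \<open>exp (- principal_log k lam * ln k)\<close>, which is
  \<open>1 / lam\<close>.\<close>

lemma log_periodic_dilation_ratio:
  fixes f C h :: "real \<Rightarrow> complex"
  assumes k: "k \<ge> 2" and lam: "lam \<noteq> 0"
    and C: "\<forall>x\<in>{0<..<1}. C x \<noteq> 0" "\<forall>x\<in>{0<..<1}. C x = C (x ^ k)"
    and h: "(h \<longlongrightarrow> 0) (at_left 1)"
    and f: "\<forall>\<^sub>F x in at_left 1. f x = C x / exp (principal_log k lam * of_real (ln (1 - x))) * (1 + h x)"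
  shows "((\<lambda>x. f (x ^ k) / f x) \<longlongrightarrow> inverse lam) (at_left 1)"
    and "\<forall>\<^sub>F x in at_left 1. f x \<noteq> 0"
proof -
  define L where "L = principal_log k lam"
  define q where "q = (\<lambda>x::real. \<Sum>i<k. x ^ i)"
  have pk: "filterlim (\<lambda>x::real. x ^ k) (at_left 1) (at_left 1)"
    using k by (intro filterlim_power_at_left_1) auto
  have 01: "\<forall>\<^sub>F x::real in at_left 1. x \<in> {0<..<1}"
    by (rule eventually_at_left_real) auto
  have "((\<lambda>x. 1 + h x) \<longlongrightarrow> 1 + 0) (at_left 1)"
    by (intro tendsto_intros h)
  hence h1: "\<forall>\<^sub>F x in at_left 1. 1 + h x \<noteq> 0"
    by (rule tendsto_imp_eventually_ne) auto
  show "\<forall>\<^sub>F x in at_left 1. f x \<noteq> 0"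
    using f 01 h1 by eventually_elim (use C in auto)
  have hk: "((\<lambda>x. h (x ^ k)) \<longlongrightarrow> 0) (at_left 1)"
    by (rule filterlim_compose[OF h pk])
  have "((\<lambda>x. exp (- L * of_real (ln (q x))) * ((1 + h (x ^ k)) / (1 + h x)))
          \<longlongrightarrow> exp (- L * of_real (ln (real k))) * ((1 + 0) / (1 + 0))) (at_left 1)"
    unfolding q_def using k
    by (intro tendsto_intros h hk tendsto_geometric_sum_at_left_1) auto
  moreover have "exp (- L * of_real (ln (real k))) = inverse lam"
    using k lam by (simp add: L_def principal_log_def exp_minus)
  ultimately have "((\<lambda>x. exp (- L * of_real (ln (q x))) * ((1 + h (x ^ k)) / (1 + h x)))
          \<longlongrightarrow> inverse lam) (at_left 1)" by simp
  moreover have "\<forall>\<^sub>F x in at_left 1.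
      exp (- L * of_real (ln (q x))) * ((1 + h (x ^ k)) / (1 + h x)) = f (x ^ k) / f x"
    using f eventually_compose_filterlim[OF f pk] 01 h1
  proof eventually_elim
    case (elim x)
    have "x ^ k < 1" using elim(3) k by (simp add: power_less_one_iff)
    have "1 - x ^ k = (1 - x) * q x"
      unfolding q_def by (rule one_diff_power_eq)
    moreover from this have "q x > 0"
      using elim(3) \<open>x ^ k < 1\<close> by (metis diff_gt_0_iff_gt greaterThanLessThan_iff zero_less_mult_pos)
    ultimately have "ln (1 - x ^ k) = ln (1 - x) + ln (q x)"
      using elim(3) by (simp add: ln_mult)
    hence "exp (L * of_real (ln (1 - x ^ k))) = exp (L * of_real (ln (1 - x))) * exp (L * of_real (ln (q x)))"
      by (simp add: algebra_simps exp_add)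
    moreover have "C x \<noteq> 0" "C (x ^ k) = C x" using C elim(3) by auto
    moreover have "inverse v * (a / b) = (c / (u * v) * a) / (c / u * b)"
      if "u \<noteq> 0" "v \<noteq> 0" "b \<noteq> 0" "c \<noteq> 0" for a b c u v :: complex
      using that by (simp add: field_simps)
    moreover have "exp (- L * of_real (ln (q x))) = inverse (exp (L * of_real (ln (q x))))"
      by (simp add: exp_minus)
    ultimately show ?case
      using elim(4) exp_not_eq_zero unfolding elim(1,2) L_def[symmetric] by metis
  qed
  ultimately show "((\<lambda>x. f (x ^ k) / f x) \<longlongrightarrow> inverse lam) (at_left 1)"
    by (rule Lim_transform_eventually)
qed

section \<open>Transcendence\<close>

theorem theorem2:
  fixes k d :: nat
    and a :: "nat \<Rightarrow> complex poly"
    and F :: "complex fps"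
    and lam :: complex
  assumes "k \<ge> 2"
    and "mahler_equation k d a F"
    and "fps_conv_radius F \<ge> 1"
    and "mahler_eigenvalue k d a F lam"
    and "\<And>n :: int. lam \<noteq> of_nat k powi n"
  shows "transcendental_fps F"
proof (rule ccontr)
  assume "\<not> transcendental_fps F"
  then obtain P where P: "P \<noteq> 0" "annihilates P (eval_fps F)"
    by (rule annihilator_of_algebraic[OF _ assms(3)])
  obtain X where X: "finite X" "\<forall>\<zeta>. norm \<zeta> = 1 \<longrightarrow> \<zeta> \<notin> X \<longrightarrow> extends_mero (eval_fps F) \<zeta>"
    by (rule extends_mero_cofinite[OF holomorphic_on_unit_disc_eval_fps[OF assms(3)] P])
  have "extends_mero (eval_fps F) 1"
  proof (rule extends_mero_at_one[OF assms(1) _ _ X(1)])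
    show "(\<Sum>i\<le>d. poly (a i) z * eval_fps F (z ^ (k ^ i))) = 0" if "z \<in> ball 0 1" for z
      by (rule mahler_functional_equation[OF assms(2,3,1) that])
    show "a d \<noteq> 0" using assms(2) by (simp add: mahler_equation_def)
  qed (use X(2) in blast)
  then obtain g where g: "g meromorphic_on {1}"
    "\<forall>\<^sub>F z in at 1 within ball 0 1. eval_fps F z = g z"
    unfolding extends_mero_def by blast
  have Fg: "\<forall>\<^sub>F x in at_left 1. eval_fps F (of_real x) = g (of_real x)"
    by (rule eventually_compose_filterlim[OF g(2) filterlim_of_real_at_left_1])
  obtain C h m M where m: "0 < m" "\<forall>x\<in>{0<..<1}. m \<le> norm (C x) \<and> norm (C x) \<le> M"
      and Ch:
      "\<forall>x\<in>{0<..<1}. C x = C (x ^ k)" "(h \<longlongrightarrow> 0) (at_left 1)"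
      "\<forall>\<^sub>F x in at_left 1. eval_fps F (of_real x) =
         C x / exp (principal_log k lam * of_real (ln (1 - x))) * (1 + h x)"
    using assms(4) unfolding mahler_eigenvalue_def by (elim conjE exE) (rule that)
  have lam: "lam \<noteq> 0"
    using assms(4) unfolding mahler_eigenvalue_def by (rule conjunct1)
  have C0: "\<forall>x\<in>{0<..<1}. C x \<noteq> 0"
    using m by fastforce
  note asym = log_periodic_dilation_ratio[OF assms(1) lam C0 Ch]
  have nz: "\<exists>\<^sub>F z in at 1. g z \<noteq> 0"
    unfolding frequently_def
  proof
    assume "\<forall>\<^sub>F z in at 1. \<not> g z \<noteq> 0"
    moreover have "filterlim complex_of_real (at 1) (at_left 1)"
      by (rule filterlim_mono[OF filterlim_of_real_at_left_1]) (auto simp: at_le)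
    ultimately have "\<forall>\<^sub>F x in at_left 1. \<not> g (of_real x) \<noteq> 0"
      by (rule eventually_compose_filterlim)
    with asym(2) Fg have "\<forall>\<^sub>F x in at_left (1::real). False"
      by eventually_elim simp
    thus False by simp
  qed
  obtain n where "((\<lambda>x::real. g (of_real (x ^ k)) / g (of_real x)) \<longlongrightarrow> of_nat k powi n) (at_left 1)"
    by (rule meromorphic_dilation_ratio[OF g(1) nz assms(1)])
  moreover have "((\<lambda>x. g (of_real (x ^ k)) / g (of_real x)) \<longlongrightarrow> inverse lam) (at_left 1)"
  proof (rule Lim_transform_eventually[OF asym(1)])
    have "filterlim (\<lambda>x::real. x ^ k) (at_left 1) (at_left 1)"
      using assms(1) by (intro filterlim_power_at_left_1) auto
    from eventually_compose_filterlim[OF Fg this] Fg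
    show "\<forall>\<^sub>F x in at_left 1. eval_fps F (of_real (x ^ k)) / eval_fps F (of_real x) =
            g (of_real (x ^ k)) / g (of_real x)"
      by eventually_elim simp
  qed
  ultimately have "inverse lam = of_nat k powi n"
    by (intro tendsto_unique[of "at_left (1::real)"]) auto
  hence "lam = of_nat k powi (- n)"
    by (metis inverse_inverse_eq power_int_minus)
  thus False using assms(5) by blast
qed

end
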